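(* Let $r\ge1$, $\Omega=\{1,\dots,r\}$, let $n_1,\dots,n_r\ge2$ be pairwise coprime integers and $m_1,\dots,m_r\in\mathbb{Z}$, and assume that for every nonempty $I\subseteq\Omega$ the integers $[\mathbf n(I)]:=\prod_{i\in I}n_i$ and $|\mathbf m(I)|:=\sum_{i\in I}m_i$ are coprime. Then $$Z_q(s;\sigma_{n_1,m_1},\dots,\sigma_{n_r,m_r})=\prod_{\emptyset\neq I\subseteq J\subseteq\Omega}\zeta\big(s,\sigma_{[\mathbf n(I)],|\mathbf m(J)|};\beta_{[\mathbf n(I)],q}\big)^{(-1)^{\#J-\#I}}.$$
   Context: $\sigma_{n,m}:=(\sigma_1\cdots\sigma_{n-1})^m\in\mathrm{B}_n$ (braid group with standard generators $\sigma_i$). The Burau representation $\beta_{n,q}$ is given by $\beta_{n,q}(\sigma_i)=I_{i-1}\oplus\begin{pmatrix}1-q&1\\ q&0\end{pmatrix}\oplus I_{n-i-1}$ over $\mathbb{Z}[q^{\pm1}]$, and $\zeta(s,\sigma;\beta_{n,q}):=\det(I_n-\beta_{n,q}(\sigma)s)^{-1}$. For $\tau_k\in\mathrm{B}_{n_k}$ ($1\le k\le r$), $Z_q(s;\tau_1,\dots,\tau_r):=\det\big(I_{n_1\cdots n_r}-\beta_{n_1,q}(\tau_1)\otimes\cdots\otimes\beta_{n_r,q}(\tau_r)\,s\big)^{-1}$, with $\otimes$ the Kronecker tensor product of matrices. *)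

theory Defs
  imports "Jordan_Normal_Form.Determinant" "Jordan_Normal_Form.Gauss_Jordan_Elimination"
          "HOL-Computational_Algebra.Fraction_Field"
begin

(* Coefficient field Q(q) = fraction field of Z[q]; it contains Z[q, q^-1]. *)
type_synonym qfield = "int poly fract"

definition qvar :: qfield where "qvar = Fract [:0, 1:] 1"

(* Burau matrix of the standard generator sigma_i (1 <= i <= n-1), 0-based rows/cols *)
definition burau_gen :: "nat \<Rightarrow> 'a::comm_ring_1 \<Rightarrow> nat \<Rightarrow> 'a mat" where
  "burau_gen n q i = mat n n (\<lambda>(a, b).
     if a = i - 1 \<and> b = i - 1 then 1 - q
     else if a = i - 1 \<and> b = i then 1
     else if a = i \<and> b = i - 1 then q
     else if a = i \<and> b = i then 0
     else if a = b then 1 else 0)"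

definition burau_cox :: "nat \<Rightarrow> 'a::comm_ring_1 \<Rightarrow> 'a mat" where
  "burau_cox n q = foldl (\<lambda>A i. A * burau_gen n q i) (1\<^sub>m n) [1..<n]"

definition burau_sigma :: "nat \<Rightarrow> int \<Rightarrow> 'a::field \<Rightarrow> 'a mat" where
  "burau_sigma n m q = (if 0 \<le> m then burau_cox n q ^\<^sub>m nat m
                        else (the (mat_inverse (burau_cox n q))) ^\<^sub>m nat (- m))"

definition kron :: "'a::times mat \<Rightarrow> 'a mat \<Rightarrow> 'a mat" where
  "kron A B = mat (dim_row A * dim_row B) (dim_col A * dim_col B)
     (\<lambda>(i, j). A $$ (i div dim_row B, j div dim_col B) * B $$ (i mod dim_row B, j mod dim_col B))"

definition kron_list :: "'a::comm_ring_1 mat list \<Rightarrow> 'a mat" where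
  "kron_list As = foldr kron As (1\<^sub>m 1)"

definition det_Is :: "'a::field mat \<Rightarrow> 'a poly" where
  "det_Is A = det (1\<^sub>m (dim_row A) - [:0, 1:] \<cdot>\<^sub>m map_mat (\<lambda>x. [:x:]) A)"

definition zeta_mat :: "'a::field mat \<Rightarrow> 'a poly fract" where
  "zeta_mat A = inverse (Fract (det_Is A) 1)"

definition zeta_burau :: "nat \<Rightarrow> int \<Rightarrow> qfield poly fract" where
  "zeta_burau n m = zeta_mat (burau_sigma n m qvar)"

definition Zq :: "nat \<Rightarrow> (nat \<Rightarrow> nat) \<Rightarrow> (nat \<Rightarrow> int) \<Rightarrow> qfield poly fract" where
  "Zq r n m = zeta_mat (kron_list (map (\<lambda>k. burau_sigma (n k) (m k) qvar) [1..<r+1]))"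

end

theory Submission
  imports Defs "HOL-Computational_Algebra.Polynomial_FPS"
begin

text \<open>
  In characteristic 0 the polynomial \<open>D(s) = det (I - A s)\<close> is determined by the traces of the powers
  of \<open>A\<close>: Jacobi's formula gives \<open>D' = - D \<cdot> (\<Sum>k. tr (A\<^bsup>k+1\<^esup>) s\<^sup>k)\<close>. So the product formula reduces
  to an identity between traces, and traces are multiplicative for Kronecker products.

  The Burau matrix of \<open>\<sigma>\<^sub>1 \<cdots> \<sigma>\<^bsub>n-1\<^esub>\<close> is \<open>q P + (1 - q) e\<^sub>0 \<one>\<^sup>T\<close> with \<open>P\<close> the cyclic permutation matrix.
  Its integer powers keep this shape, so the \<open>k\<close>-th power of the matrix of \<open>\<sigma>\<^bsub>n,m\<^esub>\<close>, with \<open>n\<close> and \<open>m\<close>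
  coprime, has trace \<open>1 + q\<^bsup>mk\<^esup> (n [n | k] - 1)\<close>. The trace identity is then inclusion-exclusion for
  \<open>\<Prod>i. (1 + c\<^sub>i (u\<^sub>i - 1))\<close> with \<open>c\<^sub>i = q\<^bsup>k m(i)\<^esup>\<close> and \<open>u\<^sub>i = n\<^sub>i [n\<^sub>i | k]\<close>.
\<close>

section \<open>Traces of powers determine \<open>det (I - A s)\<close>\<close>

definition mat_trace :: "'a::comm_monoid_add mat \<Rightarrow> 'a" where
  "mat_trace A = (\<Sum>i<dim_row A. A $$ (i, i))"

text \<open>Jacobi's formula. The product rule on each Leibniz term, regrouped by the row where the
  derivative lands, gives the determinants of \<open>M\<close> with one row differentiated.
  Expanding along that row involves only cofactors of \<open>M\<close> itself, since the altered row
  is deleted.\<close>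

lemma pderiv_det:
  fixes M :: "'a::idom poly mat"
  assumes M: "M \<in> carrier_mat n n"
  shows "pderiv (det M) = (\<Sum>i<n. \<Sum>j<n. pderiv (M $$ (i, j)) * cofactor M i j)"
proof -
  define R where "R i = mat n n (\<lambda>(a, b). if a = i then pderiv (M $$ (a, b)) else M $$ (a, b))" for i
  have R: "R i \<in> carrier_mat n n" for i by (simp add: R_def)
  have pd_sign: "pderiv (signof p * f) = signof p * pderiv f" for p :: "nat \<Rightarrow> nat" and f :: "'a poly"
    by (auto simp: sign_def pderiv_minus)
  have pd_sum: "pderiv (sum f S) = (\<Sum>x\<in>S. pderiv (f x))" for f :: "(nat \<Rightarrow> nat) \<Rightarrow> 'a poly" and S
    by (induction S rule: infinite_finite_induct) (simp_all add: pderiv_add)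
  have "pderiv (det M) = (\<Sum>p | p permutes {0..<n}. signof p *
      (\<Sum>i\<in>{0..<n}. (\<Prod>a\<in>{0..<n} - {i}. M $$ (a, p a)) * pderiv (M $$ (i, p i))))"
    by (simp add: det_def'[OF M] pd_sum pd_sign pderiv_prod)
  also have "\<dots> = (\<Sum>p | p permutes {0..<n}. \<Sum>i\<in>{0..<n}. signof p * (\<Prod>a = 0..<n. R i $$ (a, p a)))"
  proof (intro sum.cong refl, subst sum_distrib_left, intro sum.cong refl)
    fix p i assume p: "p \<in> {p. p permutes {0..<n}}" and i: "i \<in> {0..<n}"
    have pl: "p a < n" if "a < n" for a using p that permutes_in_image[of p "{0..<n}" a] by auto
    have "(\<Prod>a = 0..<n. R i $$ (a, p a)) = R i $$ (i, p i) * (\<Prod>a\<in>{0..<n} - {i}. R i $$ (a, p a))"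
      using i by (intro prod.remove) auto
    also have "R i $$ (i, p i) = pderiv (M $$ (i, p i))" using i pl by (simp add: R_def)
    also have "(\<Prod>a\<in>{0..<n} - {i}. R i $$ (a, p a)) = (\<Prod>a\<in>{0..<n} - {i}. M $$ (a, p a))"
      using pl by (intro prod.cong) (auto simp: R_def)
    finally show "signof p * ((\<Prod>a\<in>{0..<n} - {i}. M $$ (a, p a)) * pderiv (M $$ (i, p i))) =
        signof p * (\<Prod>a = 0..<n. R i $$ (a, p a))" by (simp add: mult.commute)
  qed
  also have "\<dots> = (\<Sum>i\<in>{0..<n}. det (R i))"
    by (subst sum.swap) (simp add: det_def'[OF R])
  also have "\<dots> = (\<Sum>i<n. det (R i))" by (simp add: atLeast0LessThan)
  also have "\<dots> = (\<Sum>i<n. \<Sum>j<n. pderiv (M $$ (i, j)) * cofactor M i j)"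
  proof (intro sum.cong refl)
    fix i assume i: "i \<in> {..<n}"
    have "mat_delete (R i) i j = mat_delete M i j" for j
      using M by (intro eq_matI) (auto simp: mat_delete_def R_def)
    then have "cofactor (R i) i j = cofactor M i j" for j
      by (simp add: cofactor_def)
    then show "det (R i) = (\<Sum>j<n. pderiv (M $$ (i, j)) * cofactor M i j)"
      using i by (subst laplace_expansion_row[OF R, of i]) (auto simp: R_def intro!: sum.cong)
  qed
  finally show ?thesis .
qed

text \<open>Newton's identities, read off from Jacobi's formula once the adjugate of
  \<open>I - A s\<close> is known to be its determinant times the geometric series in
  \<open>A s\<close>.\<close>

lemma coeff_det_Is_recurrence:
  fixes A :: "'a::field mat"
  assumes A: "A \<in> carrier_mat n n"
  shows "of_nat (Suc k) * coeff (det_Is A) (Suc k) =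
    - (\<Sum>i\<le>k. coeff (det_Is A) i * mat_trace (A ^\<^sub>m Suc (k - i)))"
proof -
  define M where "M = 1\<^sub>m n - [:0, 1:] \<cdot>\<^sub>m map_mat (\<lambda>x. [:x:]) A"
  have M: "M \<in> carrier_mat n n" using A by (auto simp: M_def)
  have D: "det_Is A = det M" using A by (simp add: det_Is_def M_def)
  have Mij: "M $$ (i, j) = (if i = j then 1 else 0) - [:0, A $$ (i, j):]" if "i < n" "j < n" for i j
    using A that by (simp add: M_def)
  define N where "N = adj_mat M"
  have N: "N \<in> carrier_mat n n" unfolding N_def by (rule adj_mat(1)[OF M])
  \<comment> \<open>This is \<open>N * M = det M\<close> times the identity, written as
    \<open>N - s N A\<close> because \<open>M = I - A s\<close>.\<close>
  have Nentry: "N $$ (a, b) - (\<Sum>c<n. N $$ (a, c) * [:0, A $$ (c, b):]) = (if a = b then det M else 0)"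
    if a: "a < n" and b: "b < n" for a b
  proof -
    have "(N * M) $$ (a, b) = (\<Sum>c<n. N $$ (a, c) * M $$ (c, b))"
      using N M a b by (simp add: scalar_prod_def atLeast0LessThan)
    also have "\<dots> = (\<Sum>c<n. (if c = b then N $$ (a, c) else 0) - N $$ (a, c) * [:0, A $$ (c, b):])"
      using b by (intro sum.cong refl) (simp add: Mij algebra_simps)
    also have "\<dots> = N $$ (a, b) - (\<Sum>c<n. N $$ (a, c) * [:0, A $$ (c, b):])"
      using b by (simp add: sum_subtractf)
    also have "N * M = det M \<cdot>\<^sub>m 1\<^sub>m n" unfolding N_def by (rule adj_mat(3)[OF M])
    finally have eq: "(det M \<cdot>\<^sub>m 1\<^sub>m n) $$ (a, b) = N $$ (a, b) - (\<Sum>c<n. N $$ (a, c) * [:0, A $$ (c, b):])" .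
    show ?thesis unfolding eq[symmetric] using a b by simp
  qed
  \<comment> \<open>The geometric series, coefficient by coefficient:
    \<open>N = det M + s N A\<close> expresses row \<open>a\<close> of coefficient
    \<open>k + 1\<close> through the same row of coefficient \<open>k\<close>, so the column
    \<open>b\<close> must vary in the induction.\<close>
  have Ncoeff: "coeff (N $$ (a, b)) k = (\<Sum>i\<le>k. coeff (det M) i * (A ^\<^sub>m (k - i)) $$ (a, b))"
    if a: "a < n" and b: "b < n" for a b k
    using b
  proof (induction k arbitrary: b)
    case 0
    from Nentry[OF a 0] have "N $$ (a, b) = (if a = b then det M else 0) + (\<Sum>c<n. N $$ (a, c) * [:0, A $$ (c, b):])"
      by (simp add: algebra_simps)
    then show ?case using A a 0 by (simp add: coeff_sum)
  next
    case (Suc k)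
    from Nentry[OF a Suc.prems] have "N $$ (a, b) = (if a = b then det M else 0) + (\<Sum>c<n. N $$ (a, c) * [:0, A $$ (c, b):])"
      by (simp add: algebra_simps)
    then have "coeff (N $$ (a, b)) (Suc k) = (if a = b then coeff (det M) (Suc k) else 0) +
        (\<Sum>c<n. coeff (N $$ (a, c)) k * A $$ (c, b))"
      by (simp add: coeff_sum mult.commute)
    also have "(\<Sum>c<n. coeff (N $$ (a, c)) k * A $$ (c, b)) =
        (\<Sum>c<n. \<Sum>i\<le>k. coeff (det M) i * ((A ^\<^sub>m (k - i)) $$ (a, c) * A $$ (c, b)))"
      by (intro sum.cong refl) (simp add: Suc.IH sum_distrib_right mult.assoc)
    also have "\<dots> = (\<Sum>i\<le>k. coeff (det M) i * (A ^\<^sub>m (Suc k - i)) $$ (a, b))"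
    proof (subst sum.swap, intro sum.cong refl)
      fix i assume "i \<in> {..k}"
      then have "A ^\<^sub>m (Suc k - i) = A ^\<^sub>m (k - i) * A" by (simp add: Suc_diff_le)
      then have "(A ^\<^sub>m (Suc k - i)) $$ (a, b) = (\<Sum>c<n. (A ^\<^sub>m (k - i)) $$ (a, c) * A $$ (c, b))"
        using A a Suc.prems by (simp add: scalar_prod_def atLeast0LessThan)
      then show "(\<Sum>c<n. coeff (det M) i * ((A ^\<^sub>m (k - i)) $$ (a, c) * A $$ (c, b))) =
          coeff (det M) i * (A ^\<^sub>m (Suc k - i)) $$ (a, b)"
        by (simp add: sum_distrib_left)
    qed
    finally show ?case using A a Suc.prems by simp
  qed
  have tr: "mat_trace (A ^\<^sub>m Suc e) = (\<Sum>i<n. \<Sum>j<n. A $$ (i, j) * (A ^\<^sub>m e) $$ (j, i))" for e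
  proof -
    have "mat_trace (A ^\<^sub>m Suc e) = (\<Sum>j<n. \<Sum>i<n. (A ^\<^sub>m e) $$ (j, i) * A $$ (i, j))"
      using A by (simp add: mat_trace_def scalar_prod_def atLeast0LessThan)
    also have "\<dots> = (\<Sum>i<n. \<Sum>j<n. A $$ (i, j) * (A ^\<^sub>m e) $$ (j, i))"
      by (subst sum.swap) (simp add: mult.commute)
    finally show ?thesis .
  qed
  have "of_nat (Suc k) * coeff (det_Is A) (Suc k) = coeff (pderiv (det M)) k"
    by (simp add: D coeff_pderiv)
  \<comment> \<open>The derivative of entry \<open>(i, j)\<close> of \<open>I - A s\<close> is
    \<open>- A $$ (i, j)\<close>, and its cofactor is entry \<open>(j, i)\<close> of the
    adjugate.\<close>
  also have "pderiv (det M) = (\<Sum>i<n. \<Sum>j<n. - smult (A $$ (i, j)) (N $$ (j, i)))"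
  proof (subst pderiv_det[OF M], intro sum.cong refl)
    fix i j assume "i \<in> {..<n}" "j \<in> {..<n}"
    then show "pderiv (M $$ (i, j)) * cofactor M i j = - smult (A $$ (i, j)) (N $$ (j, i))"
      using M by (simp add: Mij N_def adj_mat_def pderiv_diff pderiv_pCons)
  qed
  also have "coeff \<dots> k = - (\<Sum>i<n. \<Sum>j<n. \<Sum>l\<le>k. coeff (det M) l * (A $$ (i, j) * (A ^\<^sub>m (k - l)) $$ (j, i)))"
    by (simp add: coeff_sum sum_negf Ncoeff sum_distrib_left mult_ac)
  also have "(\<Sum>i<n. \<Sum>j<n. \<Sum>l\<le>k. coeff (det M) l * (A $$ (i, j) * (A ^\<^sub>m (k - l)) $$ (j, i))) =
      (\<Sum>l\<le>k. coeff (det M) l * mat_trace (A ^\<^sub>m Suc (k - l)))"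
    unfolding tr sum_distrib_left sum.swap[where B = "{..k}"] ..
  finally show ?thesis by (simp only: D)
qed

text \<open>Evaluation at \<open>s = 0\<close> is a ring homomorphism, so it commutes with
  \<open>det\<close>, and it maps \<open>I - A s\<close> to the identity.\<close>

lemma coeff_0_det_Is:
  assumes A: "A \<in> carrier_mat n n"
  shows "coeff (det_Is A) 0 = 1"
proof -
  interpret comm_ring_hom "\<lambda>p. coeff p 0 :: 'a"
    by unfold_locales (simp_all add: coeff_mult)
  have "map_mat (\<lambda>p. coeff p 0) (1\<^sub>m n - [:0, 1:] \<cdot>\<^sub>m map_mat (\<lambda>x. [:x:]) A) = 1\<^sub>m n"
    using A by (intro eq_matI) auto
  from arg_cong[OF this, of det] show ?thesis
    using A by (simp add: det_Is_def)
qed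


text \<open>Only the values \<open>t k\<close> with \<open>k \<ge> 1\<close> matter; the index is shifted so that \<open>t k\<close> is the \<open>k\<close>-th power sum.\<close>
definition has_log_deriv :: "'a::field poly \<Rightarrow> (nat \<Rightarrow> 'a) \<Rightarrow> bool" where
  "has_log_deriv f t \<longleftrightarrow> coeff f 0 = 1 \<and>
     fps_of_poly (pderiv f) = - fps_of_poly f * Abs_fps (\<lambda>k. t (Suc k))"

lemma has_log_deriv_det_Is:
  assumes A: "A \<in> carrier_mat n n"
  shows "has_log_deriv (det_Is A) (\<lambda>k. mat_trace (A ^\<^sub>m k))"
  unfolding has_log_deriv_def
proof
  show "coeff (det_Is A) 0 = 1" by (rule coeff_0_det_Is[OF A])
  show "fps_of_poly (pderiv (det_Is A)) = - fps_of_poly (det_Is A) * Abs_fps (\<lambda>k. mat_trace (A ^\<^sub>m Suc k))"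
  proof (rule fps_ext)
    fix k
    show "fps_nth (fps_of_poly (pderiv (det_Is A))) k =
      fps_nth (- fps_of_poly (det_Is A) * Abs_fps (\<lambda>k. mat_trace (A ^\<^sub>m Suc k))) k"
      unfolding fps_of_poly_nth coeff_pderiv coeff_det_Is_recurrence[OF A]
      by (simp add: fps_mult_nth atLeast0AtMost sum_negf)
  qed
qed

lemma has_log_deriv_1: "has_log_deriv 1 (\<lambda>k. 0)"
  by (simp add: has_log_deriv_def fps_zero_def[symmetric])

text \<open>Logarithmic derivatives add under products. Stating the relation as
  \<open>f' = - f T\<close> in power series keeps it free of division.\<close>

lemma has_log_deriv_mult:
  assumes "has_log_deriv f t" and "has_log_deriv g u"
  shows "has_log_deriv (f * g) (\<lambda>k. t k + u k)"
proof -
  have "Abs_fps (\<lambda>k. t (Suc k) + u (Suc k)) = Abs_fps (\<lambda>k. t (Suc k)) + Abs_fps (\<lambda>k. u (Suc k))"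
    by (simp add: fps_eq_iff)
  then show ?thesis using assms
    by (simp add: has_log_deriv_def coeff_mult pderiv_mult fps_of_poly_add fps_of_poly_mult algebra_simps)
qed

lemma has_log_deriv_prod:
  assumes "finite S" and "\<And>x. x \<in> S \<Longrightarrow> has_log_deriv (f x) (t x)"
  shows "has_log_deriv (\<Prod>x\<in>S. f x) (\<lambda>k. \<Sum>x\<in>S. t x k)"
  using assms by (induction S rule: finite_induct) (auto simp: has_log_deriv_1 has_log_deriv_mult)

text \<open>The differential equation gives \<open>k + 1\<close> times coefficient
  \<open>k + 1\<close> in terms of the earlier coefficients, and in characteristic 0 the factor
  \<open>k + 1\<close> cancels.\<close>

lemma has_log_deriv_unique:
  fixes f g :: "'a::field_char_0 poly"
  assumes f: "has_log_deriv f t" and g: "has_log_deriv g u" and tu: "\<And>k. t (Suc k) = u (Suc k)"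
  shows "f = g"
proof -
  have rec: "of_nat (Suc k) * coeff h (Suc k) = - (\<Sum>i\<le>k. coeff h i * w (Suc (k - i)))"
    if "has_log_deriv h w" for h w and k :: nat
  proof -
    from that have "fps_nth (fps_of_poly (pderiv h)) k =
        fps_nth (- fps_of_poly h * Abs_fps (\<lambda>k. w (Suc k))) k"
      by (simp add: has_log_deriv_def)
    then show ?thesis by (simp add: coeff_pderiv fps_mult_nth atLeast0AtMost sum_negf)
  qed
  have "coeff f k = coeff g k" for k
  proof (induction k rule: less_induct)
    case (less k)
    show ?case
    proof (cases k)
      case 0
      then show ?thesis using f g by (simp add: has_log_deriv_def)
    next
      case (Suc l)
      have "(\<Sum>i\<le>l. coeff f i * t (Suc (l - i))) = (\<Sum>i\<le>l. coeff g i * u (Suc (l - i)))"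
        using less.IH Suc tu by (intro sum.cong) auto
      then have "of_nat (Suc l) * coeff f (Suc l) = of_nat (Suc l) * coeff g (Suc l)"
        unfolding rec[OF f] rec[OF g] by simp
      then show ?thesis
        unfolding Suc by (simp del: of_nat_Suc)
    qed
  qed
  then show ?thesis by (simp add: poly_eq_iff)
qed

section \<open>Powers and traces of Kronecker products\<close>

text \<open>Matches the indexing of \<open>kron\<close>: a flat index \<open>k = i * b + j\<close>
  stands for the pair \<open>(i, j)\<close>.\<close>

lemma sum_div_mod_eq:
  fixes f :: "nat \<Rightarrow> nat \<Rightarrow> 'a::comm_monoid_add"
  shows "(\<Sum>k<a * b. f (k div b) (k mod b)) = (\<Sum>i<a. \<Sum>j<b. f i j)"
proof -
  have "(\<Sum>i<a. \<Sum>j<b. f i j) = (\<Sum>(i, j)\<in>{..<a} \<times> {..<b}. f i j)"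
    by (simp add: sum.cartesian_product)
  also have "\<dots> = (\<Sum>k<a * b. f (k div b) (k mod b))"
  proof (rule sum.reindex_bij_witness[where i = "\<lambda>k. (k div b, k mod b)" and j = "\<lambda>(i, j). i * b + j"])
    fix x assume "x \<in> {..<a} \<times> {..<b}"
    then obtain i j where x: "x = (i, j)" "i < a" "j < b" by auto
    have "i * b + j < Suc i * b" using x by simp
    also have "\<dots> \<le> a * b" using x by (intro mult_right_mono) auto
    finally show "(case x of (i, j) \<Rightarrow> i * b + j) \<in> {..<a * b}" using x by simp
  next
    fix k assume "k \<in> {..<a * b}"
    then have k: "k < a * b" by simp
    then have "0 < b" by (cases b) auto
    then show "(k div b, k mod b) \<in> {..<a} \<times> {..<b}"
      using k by (simp add: less_mult_imp_div_less)
  qed auto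
  finally show ?thesis by simp
qed

lemma mod_div_less_mult:
  assumes "k < a * (b::nat)" shows "k div b < a" "k mod b < b"
proof -
  from assms have "0 < b" by (cases b) auto
  then show "k div b < a" "k mod b < b" using assms by (simp_all add: less_mult_imp_div_less)
qed

text \<open>The mixed-product property: over pairs of indices, the sum for an entry of the product
  factors into two independent sums.\<close>

lemma kron_mult:
  fixes A B A' B' :: "'a::comm_ring_1 mat"
  assumes "A \<in> carrier_mat a a" "A' \<in> carrier_mat a a" "B \<in> carrier_mat b b" "B' \<in> carrier_mat b b"
  shows "kron A B * kron A' B' = kron (A * A') (B * B')"
proof (rule eq_matI)
  fix i j assume "i < dim_row (kron (A * A') (B * B'))" "j < dim_col (kron (A * A') (B * B'))"
  then have i: "i < a * b" and j: "j < a * b" using assms by (auto simp: kron_def)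
  note ij = mod_div_less_mult[OF i] mod_div_less_mult[OF j]
  \<comment> \<open>The explicit abstraction over \<open>c\<close> and \<open>d\<close> lets
    \<open>sum_div_mod_eq\<close> match.\<close>
  have "(kron A B * kron A' B') $$ (i, j) =
     (\<Sum>k<a * b. (\<lambda>c d. (A $$ (i div b, c) * A' $$ (c, j div b)) * (B $$ (i mod b, d) * B' $$ (d, j mod b))) (k div b) (k mod b))"
    using assms i j by (simp add: kron_def scalar_prod_def atLeast0LessThan mult_ac)
  also have "\<dots> = (\<Sum>c<a. \<Sum>d<b. (A $$ (i div b, c) * A' $$ (c, j div b)) * (B $$ (i mod b, d) * B' $$ (d, j mod b)))"
    by (rule sum_div_mod_eq)
  also have "\<dots> = kron (A * A') (B * B') $$ (i, j)"
    using assms i j ij by (simp add: kron_def scalar_prod_def atLeast0LessThan sum_product)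
  finally show "(kron A B * kron A' B') $$ (i, j) = kron (A * A') (B * B') $$ (i, j)" .
qed (use assms in \<open>auto simp: kron_def\<close>)

lemma kron_pow:
  fixes A B :: "'a::comm_ring_1 mat"
  assumes A: "A \<in> carrier_mat a a" and B: "B \<in> carrier_mat b b"
  shows "kron A B ^\<^sub>m k = kron (A ^\<^sub>m k) (B ^\<^sub>m k)"
proof (induction k)
  case 0
  have "kron (1\<^sub>m a) (1\<^sub>m b) = (1\<^sub>m (a * b) :: 'a mat)"
  proof (rule eq_matI)
    fix i j assume "i < dim_row (1\<^sub>m (a * b) :: 'a mat)" "j < dim_col (1\<^sub>m (a * b) :: 'a mat)"
    then have i: "i < a * b" and j: "j < a * b" by auto
    have "i = j \<longleftrightarrow> i div b = j div b \<and> i mod b = j mod b"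
      by (metis div_mult_mod_eq)
    then show "kron (1\<^sub>m a) (1\<^sub>m b) $$ (i, j) = (1\<^sub>m (a * b) :: 'a mat) $$ (i, j)"
      using i j mod_div_less_mult[OF i] mod_div_less_mult[OF j] by (simp add: kron_def)
  qed (auto simp: kron_def)
  then show ?case using A B by (simp add: kron_def)
next
  case (Suc k)
  then show ?case using kron_mult[of "A ^\<^sub>m k" a A "B ^\<^sub>m k" b B] A B by simp
qed

lemma mat_trace_kron:
  fixes A B :: "'a::comm_ring_1 mat"
  assumes A: "A \<in> carrier_mat a a" and B: "B \<in> carrier_mat b b"
  shows "mat_trace (kron A B) = mat_trace A * mat_trace B"
proof -
  have "mat_trace (kron A B) = (\<Sum>k<a * b. (\<lambda>c d. A $$ (c, c) * B $$ (d, d)) (k div b) (k mod b))"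
    using A B by (simp add: mat_trace_def kron_def)
  also have "\<dots> = (\<Sum>c<a. \<Sum>d<b. A $$ (c, c) * B $$ (d, d))"
    by (rule sum_div_mod_eq)
  finally show ?thesis using A B by (simp add: mat_trace_def sum_product)
qed

lemma kron_list_square:
  assumes "\<And>A. A \<in> set As \<Longrightarrow> square_mat A"
  shows "square_mat (kron_list As)"
  using assms by (induction As) (auto simp: kron_list_def kron_def)

lemma mat_trace_kron_list_pow:
  fixes As :: "'a::comm_ring_1 mat list"
  assumes "\<And>A. A \<in> set As \<Longrightarrow> square_mat A"
  shows "mat_trace (kron_list As ^\<^sub>m k) = (\<Prod>A\<leftarrow>As. mat_trace (A ^\<^sub>m k))"
  using assms
proof (induction As)
  case Nil
  have "1\<^sub>m 1 ^\<^sub>m k = (1\<^sub>m 1 :: 'a mat)" by (induction k) auto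
  then show ?case by (simp add: kron_list_def mat_trace_def)
next
  case (Cons A As)
  define a where "a = dim_row A"
  define b where "b = dim_row (kron_list As)"
  have A: "A \<in> carrier_mat a a" using Cons.prems[of A] by (auto simp: a_def)
  have B: "kron_list As \<in> carrier_mat b b"
    using kron_list_square[of As] Cons.prems by (auto simp: b_def)
  have "kron_list (A # As) = kron A (kron_list As)" by (simp add: kron_list_def)
  then show ?case using Cons A B
    by (simp add: kron_pow[OF A B] mat_trace_kron[of _ a _ b])
qed


section \<open>The Burau matrix of \<open>sigma_1 ... sigma_(n-1)\<close> and its integer
  powers\<close>

lemma mult_burau_gen_entry:
  fixes X :: "'a::comm_ring_1 mat"
  assumes X: "X \<in> carrier_mat n n" and k: "1 \<le> k" "k < n" and a: "a < n" and b: "b < n"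
  shows "(X * burau_gen n q k) $$ (a, b) =
    (if b = k - 1 then (1 - q) * X $$ (a, k - 1) + q * X $$ (a, k)
     else if b = k then X $$ (a, k - 1) else X $$ (a, b))"
proof -
  have "(X * burau_gen n q k) $$ (a, b) = (\<Sum>c<n. X $$ (a, c) * burau_gen n q k $$ (c, b))"
    using X a b by (simp add: scalar_prod_def burau_gen_def atLeast0LessThan)
  \<comment> \<open>Each column of the generator has at most two nonzero entries, so the sum splits
    into single-index deltas.\<close>
  also have "\<dots> = (\<Sum>c<n. if b = k - 1 then (if c = k - 1 then (1 - q) * X $$ (a, c) else 0) + (if c = k then q * X $$ (a, c) else 0)
     else if b = k then (if c = k - 1 then X $$ (a, c) else 0) else (if c = b then X $$ (a, c) else 0))"
    using b k by (intro sum.cong refl) (auto simp: burau_gen_def)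
  also have "\<dots> = (if b = k - 1 then (1 - q) * X $$ (a, k - 1) + q * X $$ (a, k)
     else if b = k then X $$ (a, k - 1) else X $$ (a, b))"
    using b k less_imp_diff_less[OF k(2), of 1] by (simp add: sum.distrib)
  finally show ?thesis .
qed

text \<open>After \<open>k - 1\<close> factors the columns before \<open>k - 1\<close> are final,
  column \<open>k - 1\<close> is the unit vector \<open>e_0\<close>, and later columns are those of
  the identity. The next generator turns column \<open>k - 1\<close> into
  \<open>(1 - q) e_0 + q e_k\<close> and moves \<open>e_0\<close> to column
  \<open>k\<close>.\<close>

lemma foldl_burau_gen:
  fixes q :: "'a::comm_ring_1"
  assumes "1 \<le> k" "k \<le> n"
  shows "foldl (\<lambda>A i. A * burau_gen n q i) (1\<^sub>m n) [1..<k] = mat n n (\<lambda>(a, b).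
    if b < k - 1 then (if a = 0 then 1 - q else if a = Suc b then q else 0)
    else if b = k - 1 then (if a = 0 then 1 else 0)
    else if a = b then 1 else 0)"
  using assms
proof (induction k rule: dec_induct)
  case base
  then show ?case by (intro eq_matI) auto
next
  case (step k)
  define X where "X = foldl (\<lambda>A i. A * burau_gen n q i) (1\<^sub>m n) [1..<k]"
  have X: "X = mat n n (\<lambda>(a, b).
    if b < k - 1 then (if a = 0 then 1 - q else if a = Suc b then q else 0)
    else if b = k - 1 then (if a = 0 then 1 else 0)
    else if a = b then 1 else 0)"
    using step unfolding X_def by simp
  then have Xc: "X \<in> carrier_mat n n" by simp
  have "foldl (\<lambda>A i. A * burau_gen n q i) (1\<^sub>m n) [1..<Suc k] = X * burau_gen n q k"
    using step by (simp add: X_def)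
  also have "\<dots> = mat n n (\<lambda>(a, b).
    if b < Suc k - 1 then (if a = 0 then 1 - q else if a = Suc b then q else 0)
    else if b = Suc k - 1 then (if a = 0 then 1 else 0)
    else if a = b then 1 else 0)" (is "_ = ?R")
  proof (rule eq_matI)
    fix a b assume "a < dim_row ?R" "b < dim_col ?R"
    then have ab: "a < n" "b < n" by auto
    have k: "1 \<le> k" "k < n" using step by auto
    show "(X * burau_gen n q k) $$ (a, b) = ?R $$ (a, b)"
    proof -
      consider "b < k - 1" | "b = k - 1" | "b = k" | "k < b" by linarith
      then show ?thesis
        unfolding mult_burau_gen_entry[OF Xc k ab] using k ab by cases (auto simp: X)
    qed
  qed (use Xc in \<open>auto simp: burau_gen_def\<close>)
  finally show ?case .
qed

text \<open>
  In matrix terms: \<open>A = x P\<^sup>j + v \<one>\<^sup>T\<close>, where \<open>P\<close> is the cyclic permutation matrix and \<open>\<one>\<^sup>T\<close> the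
  all-one row, and where the columns of \<open>A\<close> sum to 1.
\<close>
definition burau_form :: "nat \<Rightarrow> 'a::comm_ring_1 \<Rightarrow> int \<Rightarrow> 'a mat \<Rightarrow> bool" where
  "burau_form n x j A \<longleftrightarrow> A \<in> carrier_mat n n \<and> (\<exists>v.
     (\<forall>a<n. \<forall>b<n. A $$ (a, b) = (if int n dvd int a - int b - j then x else 0) + v a) \<and>
     (\<Sum>a<n. v a) = 1 - x)"

text \<open>The powers of \<open>P\<close> are described by congruences modulo \<open>n\<close>,
  which allow negative exponents. Among the indices below \<open>n\<close> each residue class has
  one representative, so such a condition selects one summand.\<close>

lemma dvd_int_diff_iff:
  assumes "c < n"
  shows "int n dvd i - int c \<longleftrightarrow> c = nat (i mod int n)"
proof -
  have "int n dvd i - int c \<longleftrightarrow> i mod int n = int c mod int n"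
    by (simp add: mod_eq_dvd_iff)
  also have "int c mod int n = int c" using assms by simp
  finally show ?thesis using assms by auto
qed

lemma sum_residue:
  assumes "0 < n"
  shows "(\<Sum>c<n. if int n dvd i - int c then f c else 0) = f (nat (i mod int n))"
proof -
  have "(\<Sum>c<n. if int n dvd i - int c then f c else 0) = (\<Sum>c<n. if c = nat (i mod int n) then f c else 0)"
    by (intro sum.cong refl) (simp add: dvd_int_diff_iff)
  then show ?thesis using assms by (simp add: nat_less_iff)
qed

lemma sum_residue':
  assumes "0 < n"
  shows "(\<Sum>c<n. if int n dvd int c - i then f c else 0) = f (nat (i mod int n))"
  using sum_residue[OF assms, of i f] by (simp add: dvd_diff_commute)

text \<open>A cyclic shift permutes the residues. Writing the shifted value as a sum of deltas and
  swapping the sums replaces an explicit bijection.\<close>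

lemma sum_shift_mod:
  assumes n: "0 < n"
  shows "(\<Sum>a<n. f (nat ((int a - j) mod int n))) = (\<Sum>a<n. f a)"
proof -
  have "(\<Sum>a<n. f (nat ((int a - j) mod int n))) =
      (\<Sum>a<n. \<Sum>c<n. if int n dvd int a - (j + int c) then f c else 0)"
    by (intro sum.cong refl) (simp add: sum_residue[OF n, symmetric] diff_diff_eq)
  also have "\<dots> = (\<Sum>c<n. f c)"
    by (subst sum.swap) (simp add: sum_residue'[OF n])
  finally show ?thesis .
qed

lemma burau_form_1: "burau_form n 1 0 (1\<^sub>m n)"
proof -
  have "int n dvd int a - int b \<longleftrightarrow> a = b" if "a < n" "b < n" for a b
    using that dvd_int_diff_iff[of b n "int a"] by auto
  then show ?thesis unfolding burau_form_def by (auto intro!: exI[of _ "\<lambda>_. 0"])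
qed

text \<open>The all-one row 1^T satisfies \<open>1^T P = 1^T\<close> and
  \<open>1^T w = 1 - y\<close>. Hence the rank-one part of \<open>A\<close> times \<open>B\<close>
  is \<open>v 1^T (y + (1 - y)) = v 1^T\<close>, and the product is
  \<open>x y P^(j+l) + (x P^j w + v) 1^T\<close>.\<close>

lemma burau_form_mult:
  assumes n: "0 < n" and A: "burau_form n x j A" and B: "burau_form n y l B"
  shows "burau_form n (x * y) (j + l) (A * B)"
proof -
  obtain v where Ac: "A \<in> carrier_mat n n" and v: "(\<Sum>a<n. v a) = 1 - x"
    and Ae: "\<And>a b. a < n \<Longrightarrow> b < n \<Longrightarrow> A $$ (a, b) = (if int n dvd int a - int b - j then x else 0) + v a"
    using A by (auto simp: burau_form_def)
  obtain w where Bc: "B \<in> carrier_mat n n" and w: "(\<Sum>a<n. w a) = 1 - y"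
    and Be: "\<And>a b. a < n \<Longrightarrow> b < n \<Longrightarrow> B $$ (a, b) = (if int n dvd int a - int b - l then y else 0) + w a"
    using B by (auto simp: burau_form_def)
  \<comment> \<open>This is \<open>x P^j w + v\<close>: applying \<open>P^j\<close> reads
    \<open>w\<close> at the index \<open>a - j\<close> modulo \<open>n\<close>.\<close>
  define u where "u a = x * w (nat ((int a - j) mod int n)) + v a" for a
  have "(\<Sum>a<n. u a) = 1 - x * y"
    by (simp add: u_def sum.distrib sum_distrib_left[symmetric] sum_shift_mod[OF n] v w algebra_simps)
  moreover have "(A * B) $$ (a, b) = (if int n dvd int a - int b - (j + l) then x * y else 0) + u a"
    if ab: "a < n" "b < n" for a b
  proof -
    let ?c = "nat ((int a - j) mod int n)"
    have c: "?c < n" using n by (simp add: nat_less_iff)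
    have "(A * B) $$ (a, b) = (\<Sum>c<n. A $$ (a, c) * B $$ (c, b))"
      using Ac Bc ab by (simp add: scalar_prod_def atLeast0LessThan)
    also have "\<dots> = (\<Sum>c<n. (if int n dvd (int a - j) - int c then x * B $$ (c, b) else 0) +
        v a * (if int n dvd int c - (int b + l) then y else 0) + v a * w c)"
      using ab by (intro sum.cong refl) (simp add: Ae Be algebra_simps)
    also have "\<dots> = x * B $$ (?c, b) + v a * y + v a * (1 - y)"
      by (simp add: sum.distrib sum_distrib_left[symmetric] sum_residue[OF n] sum_residue'[OF n] w)
    also have "\<dots> = x * B $$ (?c, b) + v a"
      by (simp add: algebra_simps)
    also have "int n dvd int ?c - int b - l \<longleftrightarrow> int n dvd int a - int b - (j + l)"
    proof -
      have "int n dvd (int a - j) - int ?c" using dvd_int_diff_iff[OF c] by blast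
      moreover have "int a - int b - (j + l) = ((int a - j) - int ?c) + (int ?c - int b - l)" by simp
      ultimately show ?thesis by (metis dvd_add_right_iff)
    qed
    then have "x * B $$ (?c, b) + v a = (if int n dvd int a - int b - (j + l) then x * y else 0) + u a"
      by (simp add: Be[OF c ab(2)] u_def algebra_simps)
    finally show ?thesis .
  qed
  ultimately show ?thesis using Ac Bc unfolding burau_form_def by auto
qed

lemma burau_form_pow:
  assumes "0 < n" and "burau_form n x j A"
  shows "burau_form n (x ^ k) (j * int k) (A ^\<^sub>m k)"
proof (induction k)
  case 0
  have "dim_row A = n" using assms(2) by (auto simp: burau_form_def)
  then show ?case using burau_form_1[of n] by simp
next
  case (Suc k)
  then show ?case using burau_form_mult[OF assms(1) Suc assms(2)] by (simp add: algebra_simps)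
qed

text \<open>An inverse of the same shape is constructed, then identified with the result of
  \<open>mat_inverse\<close> by uniqueness of inverses.\<close>

lemma burau_form_inverse:
  fixes x :: "'a::field"
  assumes n: "0 < n" and x: "x \<noteq> 0" and A: "burau_form n x j A"
  shows "burau_form n (inverse x) (- j) (the (mat_inverse A))"
proof -
  obtain v where Ac: "A \<in> carrier_mat n n" and v: "(\<Sum>a<n. v a) = 1 - x"
    and Ae: "\<And>a b. a < n \<Longrightarrow> b < n \<Longrightarrow> A $$ (a, b) = (if int n dvd int a - int b - j then x else 0) + v a"
    using A by (auto simp: burau_form_def)
  \<comment> \<open>In \<open>B * A\<close> with \<open>B = x^(-1) P^(-j) + w 1^T\<close> the
    rank-one part is \<open>x^(-1) P^(-j) v + w\<close>, because the columns of \<open>A\<close> sum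
    to 1. This \<open>w\<close> makes it vanish.\<close>
  define w where "w a = - inverse x * v (nat ((int a + j) mod int n))" for a
  define B where "B = mat n n (\<lambda>(a, b). (if int n dvd int a - int b + j then inverse x else 0) + w a)"
  have Bc: "B \<in> carrier_mat n n" by (simp add: B_def)
  have "(\<Sum>a<n. w a) = - inverse x * (\<Sum>a<n. v a)"
    unfolding w_def sum_distrib_left[symmetric] using sum_shift_mod[OF n, of v "- j"] by simp
  also have "\<dots> = 1 - inverse x" using x by (simp add: v field_simps)
  finally have w: "(\<Sum>a<n. w a) = 1 - inverse x" .
  then have B: "burau_form n (inverse x) (- j) B"
    unfolding burau_form_def by (auto simp: B_def)
  have BA: "B * A = 1\<^sub>m n"
  proof (rule eq_matI)
    fix a b assume "a < dim_row (1\<^sub>m n :: 'a mat)" "b < dim_col (1\<^sub>m n :: 'a mat)"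
    then have ab: "a < n" "b < n" by auto
    define d where "d = nat ((int a + j) mod int n)"
    have d: "d < n" using n by (simp add: d_def nat_less_iff)
    have "(B * A) $$ (a, b) = (\<Sum>c<n. B $$ (a, c) * A $$ (c, b))"
      using Ac Bc ab by (simp add: scalar_prod_def atLeast0LessThan)
    also have "\<dots> = (\<Sum>c<n. (if int n dvd (int a + j) - int c then inverse x * A $$ (c, b) else 0) +
        w a * (if int n dvd int c - (int b + j) then x else 0) + w a * v c)"
      using ab by (intro sum.cong refl) (simp add: Ae B_def algebra_simps)
    also have "\<dots> = inverse x * A $$ (d, b) + w a * x + w a * (1 - x)"
      by (simp add: sum.distrib sum_distrib_left[symmetric] sum_residue[OF n] sum_residue'[OF n] v d_def)
    also have "\<dots> = inverse x * A $$ (d, b) + w a"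
      by (simp add: algebra_simps)
    also have "\<dots> = (if int n dvd int d - int b - j then 1 else 0)"
      using x by (simp add: Ae[OF d ab(2)] w_def d_def[symmetric] distrib_left)
    also have "int n dvd int d - int b - j \<longleftrightarrow> int n dvd int a - int b"
    proof -
      have "int n dvd (int a + j) - int d" using dvd_int_diff_iff[OF d] d_def by blast
      moreover have "int a - int b = ((int a + j) - int d) + (int d - int b - j)" by simp
      ultimately show ?thesis by (metis dvd_add_right_iff)
    qed
    also have "int n dvd int a - int b \<longleftrightarrow> a = b"
      using ab dvd_int_diff_iff[of b n "int a"] by auto
    finally show "(B * A) $$ (a, b) = (1\<^sub>m n :: 'a mat) $$ (a, b)" using ab by simp
  qed (use Ac Bc in auto)
  have AB: "A * B = 1\<^sub>m n" using mat_mult_left_right_inverse[OF Bc Ac BA] .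
  \<comment> \<open>Being a unit excludes the outcome \<open>None\<close> of
    \<open>mat_inverse\<close>.\<close>
  have "A \<in> Units (ring_mat TYPE('a) n ())"
    using Ac Bc AB BA by (auto simp: Units_def ring_mat_def)
  then obtain C where C: "mat_inverse A = Some C"
    using mat_inverse(1)[OF Ac, of "()"] by (cases "mat_inverse A") auto
  from mat_inverse(2)[OF Ac C] have "A * C = 1\<^sub>m n" and Cc: "C \<in> carrier_mat n n" by auto
  then have "C = B * A * C" using BA by simp
  also have "\<dots> = B * (A * C)" by (rule assoc_mult_mat[OF Bc Ac Cc])
  also have "\<dots> = B" using \<open>A * C = 1\<^sub>m n\<close> Bc by simp
  finally show ?thesis using B C by simp
qed

lemma burau_form_cox:
  assumes n: "0 < n"
  shows "burau_form n q 1 (burau_cox n q)"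
proof -
  have cox: "burau_cox n q = mat n n (\<lambda>(a, b).
    if b < n - 1 then (if a = 0 then 1 - q else if a = Suc b then q else 0)
    else if b = n - 1 then (if a = 0 then 1 else 0)
    else if a = b then 1 else 0)"
    unfolding burau_cox_def by (rule foldl_burau_gen) (use n in auto)
  \<comment> \<open>The support of \<open>P\<close>: column \<open>b\<close> has its entry in row
    \<open>b + 1\<close>, wrapping to row 0 in the last column, where \<open>q + (1 - q)\<close>
    gives the entry 1.\<close>
  have dvd: "int n dvd int a - int b - 1 \<longleftrightarrow> a = (if b = n - 1 then 0 else Suc b)"
    if ab: "a < n" "b < n" for a b
  proof -
    have "int n dvd int a - int b - 1 \<longleftrightarrow> int n dvd (int b + 1) - int a"
      by (subst dvd_diff_commute) (simp add: algebra_simps)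
    also have "\<dots> \<longleftrightarrow> a = nat ((int b + 1) mod int n)" by (rule dvd_int_diff_iff[OF ab(1)])
    also have "(int b + 1) mod int n = (if b = n - 1 then 0 else int (Suc b))"
      using ab by auto
    finally show ?thesis by auto
  qed
  show ?thesis unfolding burau_form_def
  proof (intro conjI exI[of _ "\<lambda>a. if a = 0 then 1 - q else 0"] allI impI)
    show "burau_cox n q \<in> carrier_mat n n" by (simp add: cox)
    show "(\<Sum>a<n. if a = 0 then 1 - q else 0) = 1 - q" using n by simp
    fix a b assume ab: "a < n" "b < n"
    show "burau_cox n q $$ (a, b) = (if int n dvd int a - int b - 1 then q else 0) + (if a = 0 then 1 - q else 0)"
      unfolding dvd[OF ab] using ab by (auto simp: cox)
  qed
qed

lemma burau_form_sigma:
  fixes q :: "'a::field"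
  assumes n: "0 < n" and q: "q \<noteq> 0"
  shows "burau_form n (q powi m) m (burau_sigma n m q)"
proof (cases "0 \<le> m")
  case True
  then show ?thesis using burau_form_pow[OF n burau_form_cox[OF n], of q "nat m"]
    by (simp add: burau_sigma_def power_int_def)
next
  case False
  then show ?thesis
    using burau_form_pow[OF n burau_form_inverse[OF n q burau_form_cox[OF n]], of "nat (- m)"]
    by (simp add: burau_sigma_def power_int_def)
qed

text \<open>On the diagonal \<open>a - b = 0\<close>, so the cyclic part contributes to all
  \<open>n\<close> entries or to none.\<close>

lemma mat_trace_burau_form:
  assumes "burau_form n x j A"
  shows "mat_trace A = 1 + x * ((if int n dvd j then of_nat n else 0) - 1)"
proof -
  obtain v where Ac: "A \<in> carrier_mat n n" and v: "(\<Sum>a<n. v a) = 1 - x"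
    and Ae: "\<And>a b. a < n \<Longrightarrow> b < n \<Longrightarrow> A $$ (a, b) = (if int n dvd int a - int b - j then x else 0) + v a"
    using assms by (auto simp: burau_form_def)
  have "mat_trace A = (\<Sum>a<n. (if int n dvd j then x else 0) + v a)"
    using Ac by (auto simp: mat_trace_def Ae)
  then show ?thesis by (simp add: sum.distrib v algebra_simps)
qed

text \<open>The \<open>k\<close>-th power carries \<open>P\<close> to the exponent
  \<open>m k\<close>. Coprimality reduces \<open>n dvd m k\<close> to \<open>n dvd k\<close>, so
  \<open>m\<close> survives only in the power of \<open>q\<close>.\<close>

lemma mat_trace_burau_sigma_pow:
  fixes q :: "'a::field"
  assumes n: "0 < n" and q: "q \<noteq> 0" and cop: "coprime (int n) m"
  shows "mat_trace (burau_sigma n m q ^\<^sub>m k) =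
    1 + (q powi m) ^ k * ((if n dvd k then of_nat n else 0) - 1)"
  using mat_trace_burau_form[OF burau_form_pow[OF n burau_form_sigma[OF n q, of m], of k]] cop
  by (simp add: coprime_dvd_mult_right_iff)


section \<open>Inclusion-exclusion for the traces\<close>

text \<open>Expanding the left side over \<open>J\<close>, and each product of
  \<open>u j - 1\<close> over \<open>I\<close>, gives signed terms c(J) u(I), writing c(J) and u(I)
  for the products. The extra \<open>1 - c(J)\<close> in each summand and the omission of
  \<open>I = {}\<close> both cancel in alternating sums.\<close>

lemma inclusion_exclusion_prod:
  fixes c u :: "'b \<Rightarrow> 'a::comm_ring_1"
  assumes fin: "finite W" and ne: "W \<noteq> {}"
  shows "(\<Prod>i\<in>W. 1 + c i * (u i - 1)) =
    (\<Sum>(I, J)\<in>{(I, J). I \<noteq> {} \<and> I \<subseteq> J \<and> J \<subseteq> W}.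
       (-1) ^ (card J - card I) * (1 + (\<Prod>j\<in>J. c j) * ((\<Prod>i\<in>I. u i) - 1)))"
proof -
  define g where "g I J = (-1) ^ (card J - card I) * (1 + (\<Prod>j\<in>J. c j) * ((\<Prod>i\<in>I. u i) - 1))" for I J
  have finJ: "finite J" if "J \<in> Pow W" for J using that fin finite_subset by auto
  have inner: "(\<Sum>I\<in>Pow J. g I J) = (\<Prod>j\<in>J. c j * (u j - 1))" if J: "J \<in> Pow W" for J
  proof -
    \<comment> \<open>The alternating sum multiplying \<open>1 - c(J)\<close> is 0 for nonempty
      \<open>J\<close>; for empty \<open>J\<close> the factor itself is 0. The products of ones are
      inserted to fit the expansion rule \<open>prod_diff_conv_sum'\<close>.\<close>
    have "(\<Sum>I\<in>Pow J. g I J) =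
        (1 - (\<Prod>j\<in>J. c j)) * (\<Sum>I\<in>Pow J. (-1) ^ (card J - card I) * (\<Prod>x\<in>I. 1) * (\<Prod>x\<in>J - I. 1)) +
        (\<Prod>j\<in>J. c j) * (\<Sum>I\<in>Pow J. (-1) ^ (card J - card I) * (\<Prod>i\<in>I. u i) * (\<Prod>x\<in>J - I. 1))"
      unfolding sum_distrib_left sum.distrib[symmetric] g_def
      by (intro sum.cong refl) (simp add: algebra_simps)
    also have "\<dots> = (1 - (\<Prod>j\<in>J. c j)) * (\<Prod>j\<in>J. 1 - 1) + (\<Prod>j\<in>J. c j) * (\<Prod>j\<in>J. u j - 1)"
      using finJ[OF J] by (simp only: prod_diff_conv_sum')
    also have "\<dots> = (\<Prod>j\<in>J. c j * (u j - 1))"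
      using finJ[OF J] by (cases "J = {}") (auto simp: prod.distrib power_0_left)
    finally show ?thesis .
  qed
  have "(\<Sum>(I, J)\<in>{(I, J). I \<noteq> {} \<and> I \<subseteq> J \<and> J \<subseteq> W}. g I J) =
      (\<Sum>(J, I)\<in>(SIGMA J:Pow W. Pow J - {{}}). g I J)"
    by (rule sum.reindex_bij_witness[of _ prod.swap prod.swap]) auto
  also have "\<dots> = (\<Sum>J\<in>Pow W. \<Sum>I\<in>Pow J - {{}}. g I J)"
    using fin finJ by (subst sum.Sigma) auto
  also have "\<dots> = (\<Sum>J\<in>Pow W. (\<Prod>j\<in>J. c j * (u j - 1)) - (-1) ^ card J)"
  proof (intro sum.cong refl)
    fix J assume J: "J \<in> Pow W"
    have "(\<Sum>I\<in>Pow J - {{}}. g I J) = (\<Sum>I\<in>Pow J. g I J) - g {} J"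
      using finJ[OF J] by (subst sum_diff1) auto
    moreover have "g {} J = (-1) ^ card J" by (simp add: g_def)
    ultimately show "(\<Sum>I\<in>Pow J - {{}}. g I J) = (\<Prod>j\<in>J. c j * (u j - 1)) - (-1) ^ card J"
      by (simp add: inner[OF J])
  qed
  \<comment> \<open>The omitted terms add up to the product of \<open>1 - 1\<close> over
    \<open>W\<close>, which is 0 because \<open>W\<close> is nonempty.\<close>
  also have "\<dots> = (\<Prod>i\<in>W. c i * (u i - 1) + 1) - (\<Prod>i\<in>W. 1 - 1)"
    unfolding prod_add[OF fin] prod_diff_conv_sum[OF fin] by (simp add: sum_subtractf)
  also have "\<dots> = (\<Prod>i\<in>W. 1 + c i * (u i - 1))"
    using fin ne by (simp add: add.commute power_0_left)
  finally show ?thesis by (simp add: g_def)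
qed

text \<open>Pairwise coprime numbers all divide \<open>k\<close> exactly when their product does.
  This merges the cycles of lengths \<open>n i\<close> into a single cycle whose length is the
  product.\<close>

lemma prod_coprime_dvd_indicator:
  fixes n :: "'b \<Rightarrow> nat"
  assumes "finite I" and "\<And>i j. i \<in> I \<Longrightarrow> j \<in> I \<Longrightarrow> i \<noteq> j \<Longrightarrow> coprime (n i) (n j)"
  shows "(\<Prod>i\<in>I. if n i dvd k then of_nat (n i) else 0) =
    (if (\<Prod>i\<in>I. n i) dvd k then of_nat (\<Prod>i\<in>I. n i) else (0 :: 'a::comm_semiring_1))"
  using assms
proof (induction I rule: finite_induct)
  case (insert x F)
  have "coprime (n x) (\<Prod>i\<in>F. n i)"
    using insert by (intro prod_coprime_right) auto
  then have "(n x * (\<Prod>i\<in>F. n i)) dvd k \<longleftrightarrow> n x dvd k \<and> (\<Prod>i\<in>F. n i) dvd k"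
    by (meson divides_mult dvd_mult_left dvd_mult_right)
  then show ?case using insert by auto
qed simp

section \<open>From trace identities to products of zeta functions\<close>

lemma Fract_prod: "Fract (\<Prod>x\<in>S. f x) 1 = (\<Prod>x\<in>S. Fract (f x) 1)"
proof (induction S rule: infinite_finite_induct)
  case (insert x F)
  then show ?case using mult_fract[of "f x" 1 "prod f F" 1] by simp
qed (simp_all add: One_fract_def)

text \<open>Moving the factors with exponent -1 to the other side turns an identity of fractions
  into one without division.\<close>

lemma inverse_Fract_eq_prod_powi:
  fixes D :: "'a::idom" and f :: "'b \<Rightarrow> 'a" and e :: "'b \<Rightarrow> nat"
  assumes fin: "finite S" and nz: "\<And>x. x \<in> S \<Longrightarrow> f x \<noteq> 0"
    and eq: "D * (\<Prod>x\<in>{x\<in>S. odd (e x)}. f x) = (\<Prod>x\<in>{x\<in>S. even (e x)}. f x)"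
  shows "inverse (Fract D 1) = (\<Prod>x\<in>S. inverse (Fract (f x) 1) powi ((-1) ^ e x))"
proof -
  define Od where "Od = (\<Prod>x\<in>{x\<in>S. odd (e x)}. Fract (f x) 1)"
  define Ev where "Ev = (\<Prod>x\<in>{x\<in>S. even (e x)}. Fract (f x) 1)"
  have "Fract (f x) 1 \<noteq> 0" if "x \<in> S" for x
    using nz[OF that] by (simp add: Zero_fract_def eq_fract)
  then have "Od \<noteq> 0" using fin by (simp add: Od_def)
  have "Fract D 1 * Od = Fract (D * (\<Prod>x\<in>{x\<in>S. odd (e x)}. f x)) 1"
    by (simp add: Od_def Fract_prod[symmetric])
  also have "\<dots> = Ev" unfolding eq by (simp add: Ev_def Fract_prod)
  finally have "inverse Ev = inverse (Fract D 1) * inverse Od" by (metis inverse_mult_distrib)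
  then have "inverse (Fract D 1) = inverse Ev * Od" using \<open>Od \<noteq> 0\<close> by simp
  also have "\<dots> = (\<Prod>x\<in>{x\<in>S. even (e x)}. inverse (Fract (f x) 1) powi ((-1) ^ e x)) *
      (\<Prod>x\<in>{x\<in>S. odd (e x)}. inverse (Fract (f x) 1) powi ((-1) ^ e x))"
    unfolding Ev_def Od_def prod_inversef[symmetric] o_def
    by (intro arg_cong2[where f = "(*)"] prod.cong refl) (auto simp: power_int_minus)
  also have "\<dots> = (\<Prod>x\<in>{x\<in>S. even (e x)} \<union> {x\<in>S. odd (e x)}. inverse (Fract (f x) 1) powi ((-1) ^ e x))"
    using fin by (intro prod.union_disjoint[symmetric]) auto
  also have "{x\<in>S. even (e x)} \<union> {x\<in>S. odd (e x)} = S" by auto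
  finally show ?thesis .
qed

text \<open>Separating even and odd signs puts polynomials on both sides; their logarithmic
  derivatives agree by the trace identity, so uniqueness applies.\<close>

lemma zeta_mat_eq_prod_powi:
  fixes A :: "'a::field_char_0 mat" and B :: "'b \<Rightarrow> 'a mat" and e :: "'b \<Rightarrow> nat"
  assumes fin: "finite S" and A: "square_mat A" and B: "\<And>x. x \<in> S \<Longrightarrow> square_mat (B x)"
    and tr: "\<And>k. mat_trace (A ^\<^sub>m k) = (\<Sum>x\<in>S. (-1) ^ e x * mat_trace (B x ^\<^sub>m k))"
  shows "zeta_mat A = (\<Prod>x\<in>S. zeta_mat (B x) powi ((-1) ^ e x))"
  unfolding zeta_mat_def
proof (rule inverse_Fract_eq_prod_powi[OF fin])
  have ldA: "has_log_deriv (det_Is A) (\<lambda>k. mat_trace (A ^\<^sub>m k))"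
    using A by (intro has_log_deriv_det_Is[of A "dim_row A"]) auto
  have ldB: "has_log_deriv (det_Is (B x)) (\<lambda>k. mat_trace (B x ^\<^sub>m k))" if "x \<in> S" for x
    using B[OF that] by (intro has_log_deriv_det_Is[of "B x" "dim_row (B x)"]) auto
  show "det_Is (B x) \<noteq> 0" if "x \<in> S" for x
    using ldB[OF that] by (auto simp: has_log_deriv_def)
  have "(\<Sum>x\<in>S. (-1) ^ e x * mat_trace (B x ^\<^sub>m k)) =
      (\<Sum>x\<in>{x\<in>S. even (e x)}. mat_trace (B x ^\<^sub>m k)) - (\<Sum>x\<in>{x\<in>S. odd (e x)}. mat_trace (B x ^\<^sub>m k))" for k
  proof -
    have "(\<Sum>x\<in>S. (-1) ^ e x * mat_trace (B x ^\<^sub>m k)) =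
        (\<Sum>x\<in>S. (if even (e x) then mat_trace (B x ^\<^sub>m k) else 0) - (if odd (e x) then mat_trace (B x ^\<^sub>m k) else 0))"
      by (intro sum.cong) auto
    then show ?thesis by (simp only: sum_subtractf sum.inter_filter[OF fin])
  qed
  then have "mat_trace (A ^\<^sub>m k) + (\<Sum>x\<in>{x\<in>S. odd (e x)}. mat_trace (B x ^\<^sub>m k)) =
      (\<Sum>x\<in>{x\<in>S. even (e x)}. mat_trace (B x ^\<^sub>m k))" for k
    by (simp add: tr)
  \<comment> \<open>Keeping \<open>pow_mat\<close> folded leaves the powers with exponent
    \<open>Suc k\<close> in the form of the trace identity.\<close>
  then show "det_Is A * (\<Prod>x\<in>{x\<in>S. odd (e x)}. det_Is (B x)) = (\<Prod>x\<in>{x\<in>S. even (e x)}. det_Is (B x))"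
    using fin
    by (intro has_log_deriv_unique[OF has_log_deriv_mult[OF ldA has_log_deriv_prod[OF _ ldB]] has_log_deriv_prod[OF _ ldB]])
      (simp_all del: pow_mat.simps)
qed

section \<open>The product formula for the Burau zeta functions\<close>

lemma power_int_sum:
  fixes q :: "'a::field"
  assumes "q \<noteq> 0"
  shows "q powi (\<Sum>j\<in>J. m j) = (\<Prod>j\<in>J. q powi m j)"
  using assms by (induction J rule: infinite_finite_induct) (simp_all add: power_int_add)

lemma square_burau_sigma:
  fixes q :: "'a::field"
  assumes "0 < n" and "q \<noteq> 0"
  shows "square_mat (burau_sigma n m q)"
  using burau_form_sigma[OF assms, of m] by (auto simp: burau_form_def)

theorem theorem3p3:
  fixes r :: nat and n :: "nat \<Rightarrow> nat" and m :: "nat \<Rightarrow> int"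
  assumes "r \<ge> 1"
    and "\<forall>i\<in>{1..r}. n i \<ge> 2"
    and "\<forall>i\<in>{1..r}. \<forall>j\<in>{1..r}. i \<noteq> j \<longrightarrow> coprime (n i) (n j)"
    and "\<forall>I. I \<noteq> {} \<and> I \<subseteq> {1..r} \<longrightarrow>
           coprime (int (\<Prod>i\<in>I. n i)) (\<Sum>i\<in>I. m i)"
  shows "Zq r n m =
    (\<Prod>(I, J)\<in>{(I, J). I \<noteq> {} \<and> I \<subseteq> J \<and> J \<subseteq> {1..r}}.
       zeta_burau (\<Prod>i\<in>I. n i) (\<Sum>j\<in>J. m j) powi ((-1) ^ (card J - card I)))"
proof -
  define S where "S = {(I, J). I \<noteq> {} \<and> I \<subseteq> J \<and> J \<subseteq> {1..r}}"
  define B where "B = (\<lambda>(I, J). burau_sigma (\<Prod>i\<in>I. n i) (\<Sum>j\<in>J. m j) qvar)"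
  define As where "As = map (\<lambda>k. burau_sigma (n k) (m k) qvar) [1..<r+1]"
  have q: "qvar \<noteq> 0" by (simp add: qvar_def Zero_fract_def eq_fract)
  have "S \<subseteq> Pow {1..r} \<times> Pow {1..r}" by (auto simp: S_def)
  then have finS: "finite S" by (rule finite_subset) simp
  have npos: "0 < n i" if "i \<in> {1..r}" for i using assms(2) that by fastforce
  have prodpos: "0 < (\<Prod>i\<in>I. n i)" if "I \<subseteq> {1..r}" for I
    using that npos by (intro prod_pos) auto
  have As: "square_mat A" if "A \<in> set As" for A
    using that npos square_burau_sigma[OF _ q] by (auto simp: As_def)
  have "zeta_mat (kron_list As) = (\<Prod>x\<in>S. zeta_mat (B x) powi ((-1) ^ (case x of (I, J) \<Rightarrow> card J - card I)))"
  proof (rule zeta_mat_eq_prod_powi[OF finS kron_list_square[OF As]])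
    show "square_mat (B x)" if "x \<in> S" for x
    proof -
      obtain I J where x: "x = (I, J)" by (cases x)
      then have "I \<subseteq> {1..r}" using that by (auto simp: S_def)
      then show ?thesis unfolding x B_def prod.case by (intro square_burau_sigma prodpos q)
    qed
    fix k
    \<comment> \<open>In the \<open>k\<close>-th power of factor \<open>i\<close>,
      \<open>c i\<close> is the coefficient of the permutation part and \<open>u i\<close> the trace
      of that permutation.\<close>
    define c where "c i = (qvar powi m i) ^ k" for i
    define u where "u i = (if n i dvd k then of_nat (n i) else 0 :: qfield)" for i
    have "mat_trace (kron_list As ^\<^sub>m k) = (\<Prod>A\<leftarrow>As. mat_trace (A ^\<^sub>m k))"
      by (rule mat_trace_kron_list_pow[OF As])
    also have "\<dots> = (\<Prod>i\<in>set [1..<r+1]. mat_trace (burau_sigma (n i) (m i) qvar ^\<^sub>m k))"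
      by (subst prod.distinct_set_conv_list) (simp_all add: As_def o_def)
    also have "set [1..<r+1] = {1..r}" by auto
    also have "(\<Prod>i\<in>{1..r}. mat_trace (burau_sigma (n i) (m i) qvar ^\<^sub>m k)) = (\<Prod>i\<in>{1..r}. 1 + c i * (u i - 1))"
    proof (intro prod.cong refl)
      fix i assume i: "i \<in> {1..r}"
      \<comment> \<open>The singleton case of the coprimality hypothesis serves the individual
        tensor factors.\<close>
      with assms(4)[rule_format, of "{i}"] have "coprime (int (n i)) (m i)" by simp
      then show "mat_trace (burau_sigma (n i) (m i) qvar ^\<^sub>m k) = 1 + c i * (u i - 1)"
        using mat_trace_burau_sigma_pow[OF npos[OF i] q] by (simp add: c_def u_def)
    qed
    also have "\<dots> = (\<Sum>(I, J)\<in>S. (-1) ^ (card J - card I) * (1 + (\<Prod>j\<in>J. c j) * ((\<Prod>i\<in>I. u i) - 1)))"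
      unfolding S_def using assms(1) by (intro inclusion_exclusion_prod) auto
    also have "\<dots> = (\<Sum>x\<in>S. (-1) ^ (case x of (I, J) \<Rightarrow> card J - card I) * mat_trace (B x ^\<^sub>m k))"
    proof (intro sum.cong refl)
      fix x assume "x \<in> S"
      then obtain I J where x: "x = (I, J)" and IJ: "I \<noteq> {}" "I \<subseteq> J" "J \<subseteq> {1..r}" by (auto simp: S_def)
      then have fin: "finite J" using finite_subset by blast
      \<comment> \<open>The pair \<open>(I, J)\<close> mixes the strand number of \<open>I\<close>
        with the exponent of \<open>J\<close>. The hypothesis for \<open>J\<close> suffices, since
        the product over \<open>I\<close> divides the product over \<open>J\<close>.\<close>
      have "coprime (int (\<Prod>i\<in>J. n i)) (\<Sum>j\<in>J. m j)" using assms(4) IJ by blast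
      moreover have "int (\<Prod>i\<in>I. n i) dvd int (\<Prod>i\<in>J. n i)"
        using prod_dvd_prod_subset[OF fin IJ(2), of n] by presburger
      ultimately have cop: "coprime (int (\<Prod>i\<in>I. n i)) (\<Sum>j\<in>J. m j)"
        by (meson coprime_divisors dvd_refl)
      have "(\<Prod>i\<in>I. u i) = (if (\<Prod>i\<in>I. n i) dvd k then of_nat (\<Prod>i\<in>I. n i) else 0)"
        unfolding u_def using IJ assms(3) finite_subset[OF IJ(2) fin]
        by (intro prod_coprime_dvd_indicator) blast+
      moreover have "(\<Prod>j\<in>J. c j) = (qvar powi (\<Sum>j\<in>J. m j)) ^ k"
        by (simp add: c_def power_int_sum[OF q] prod_power_distrib)
      ultimately have "mat_trace (B (I, J) ^\<^sub>m k) = 1 + (\<Prod>j\<in>J. c j) * ((\<Prod>i\<in>I. u i) - 1)"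
        unfolding B_def using mat_trace_burau_sigma_pow[OF prodpos q cop, of k] IJ by auto
      then show "(case x of (I, J) \<Rightarrow>
            (-1) ^ (card J - card I) * (1 + (\<Prod>j\<in>J. c j) * ((\<Prod>i\<in>I. u i) - 1))) =
          (-1) ^ (case x of (I, J) \<Rightarrow> card J - card I) * mat_trace (B x ^\<^sub>m k)"
        by (simp add: x)
    qed
    finally show "mat_trace (kron_list As ^\<^sub>m k) =
        (\<Sum>x\<in>S. (-1) ^ (case x of (I, J) \<Rightarrow> card J - card I) * mat_trace (B x ^\<^sub>m k))" .
  qed
  also have "\<dots> = (\<Prod>(I, J)\<in>S. zeta_burau (\<Prod>i\<in>I. n i) (\<Sum>j\<in>J. m j) powi ((-1) ^ (card J - card I)))"
    by (intro prod.cong) (auto simp: B_def zeta_burau_def)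
  finally show ?thesis by (simp add: Zq_def As_def S_def)
qed

end
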